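(* Fix any feasible profile $(D,H)$. Under the finite-contamination data model $\mathfrak{D}_{\mathrm{fin\text{-}cont}}$ there exists a randomized generation algorithm $\mathcal{A}=\mathcal{A}_{\mathcal{B}_{\mathrm{MVYZ}}}$ such that $\mu_{low}(\mathcal{A},D)\ge 1/2$ almost surely and, for every countable collection $\mathcal{L}$, $$\sup_{K\in\mathcal{L}}\ \sup_{X\in\mathfrak{D}_{\mathrm{fin\text{-}cont}}(K)} H_{\mathcal{A}}^{\mathcal{L},K,X}(t)\le H(t)\qquad\text{for all sufficiently large } t .$$
   Context: Game. Fix a countably infinite universe $U=(u_1,u_2,\dots)$ with a fixed bijective enumeration. A language is an infinite subset of $U$; its elements are listed in the order inherited from $U$, $K=(k_1,k_2,\dots)$, and $K_i=\{k_1,\dots,k_i\}$. A collection is a countable collection $\mathcal{L}=(L^1,L^2,\dots)$ of languages with a fixed enumeration. The adversary picks $K\in\mathcal{L}$ and an observation sequence $X=(x_1,x_2,\dots)\in\mathfrak{D}(K)$, where the data model $\mathfrak{D}$ specifies the admissible sequences in $U^{\mathbb{N}}$ for each language. A generator $\mathcal{A}$ knows $U$ and $\mathcal{L}$ and is given by (possibly randomized) maps $\mathcal{A}_t:U^t\to U$, $t\ge1$ (which may depend on $\mathcal{L}$); on $X$ it outputs $o_t=\mathcal{A}_t(x_1,\dots,x_t)$, where $o_t$ must differ from all of $o_1,\dots,o_{t-1}$ and $x_1,\dots,x_t$. Write $\mathcal{A}(X)=(o_1,o_2,\dots)$ and $\mathcal{A}(X)_t=\{o_1,\dots,o_t\}$.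 A generator is eventually consistent if on every admissible $X$ for every $K\in\mathcal{L}$ there is a finite $T$ with $o_t\in K$ for all $t\ge T$. Finite contamination. $\mathfrak{D}_{\mathrm{fin\text{-}cont}}(K)$ is the set of sequences $X$ (repetitions allowed) whose set of terms $\{x_1,x_2,\dots\}$ is infinite and satisfies $|\{x_1,x_2,\dots\}\setminus K|<\infty$ and $|K\setminus\{x_1,x_2,\dots\}|<\infty$. Hallucination rate. $H_{\mathcal{A}}^{\mathcal{L},K,X}(t)=\mathbb{E}\big[\,|\mathcal{A}(X)_t\setminus K|/t\,\big]$, expectation over the internal randomness of $\mathcal{A}$. Feasible profile. For $D:\mathbb{N}\to\mathbb{N}$ let $D^{-1}(t)=\min\{n\in\mathbb{N}:D(n)\ge t\}$. $(D,H)$ is a feasible profile if $D:\mathbb{N}\to\mathbb{N}$ is monotone non-decreasing, discrete convex (the increments $D(n+1)-D(n)$ are non-decreasing) and super-linear ($D(n)/n\to\infty$), and $H:\mathbb{N}\to\mathbb{R}_{\ge0}$ is monotone non-increasing with $H(t)\to0$ and $H(t)=\omega(D^{-1}(t)/t)$. Density. For sequences $S=(s_1,s_2,\dots)$, $R=(r_1,r_2,\dots)$, put $S_n=\{s_1,\dots,s_n\}$ and $\mu_i(S,R,D)=\frac1i\sum_{j=1}^i \mathbf{1}\{r_j\in S_{D(j)}\}$. "$\mu_{low}(\mathcal{A},D)\ge\rho$ almost surely" means: for every countable collection $\mathcal{L}$, every $K\in\mathcal{L}$ and every admissible $X$ for $K$, with probability one over the internal randomness, $\liminf_{i\to\infty}\mu_i(\mathcal{A}(X),K,D)\ge\rho$.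 Black box. $\mathcal{B}_{\mathrm{MVYZ}}$ is a deterministic eventually consistent generator (known from prior work on generation with contamination) which under $\mathfrak{D}_{\mathrm{fin\text{-}cont}}$ satisfies the guarantee (without deadlines) $\liminf_{i\to\infty}|\mathcal{B}_{\mathrm{MVYZ}}(X)\cap K_i|/i\ge 1/2$ for all $\mathcal{L}$, $K\in\mathcal{L}$ and $X\in\mathfrak{D}_{\mathrm{fin\text{-}cont}}(K)$. The notation $\mathcal{A}_{\mathcal{B}}$ indicates that $\mathcal{A}$ is built from $\mathcal{B}$ using only black-box calls to $\mathcal{B}$.
   Formalization: As printed, the sup bound with one threshold on t fails (e.g. all tails of U); proved instead: the bound for each K and X for all large t, and the sup bound over all K, X on which the black box is consistent from a common time T, for every T. *)

theory Defs
  imports "HOL-Probability.Probability" "HOL-Library.Landau_Symbols"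
begin

(* Conventions.  The universe is a type 'u together with a bijection u from nat.
   All sequences (the universe u, listings of languages, observations, outputs) are functions on
   nat and are 0-based: the n-th term of S in 1-based counting is S (n - 1), and its first n terms
   are S ` {..<n}.  The arguments of D, H, mu and the hallucination rate are times and indices
   counted from 1; their values at argument 0 are irrelevant. *)

definition language :: "'u set \<Rightarrow> bool" where
  "language K \<longleftrightarrow> infinite K"

definition listing :: "(nat \<Rightarrow> 'u) \<Rightarrow> 'u set \<Rightarrow> nat \<Rightarrow> 'u" where
  "listing u K n = u (enumerate {m. u m \<in> K} n)"

(* Repetitions in the enumeration are allowed, so finite collections are included. *)
definition collection :: "(nat \<Rightarrow> 'u set) \<Rightarrow> bool" where
  "collection L \<longleftrightarrow> (\<forall>i. language (L i))"

definition fin_cont :: "'u set \<Rightarrow> (nat \<Rightarrow> 'u) set" where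
  "fin_cont K = {X. infinite (range X) \<and> finite (range X - K) \<and> finite (K - range X)}"


section \<open>Generators\<close>

(* A realised generator is a single map on finite observation histories; its restriction to
   histories of length t is the t-th map. *)
definition outputs :: "('u list \<Rightarrow> 'u) \<Rightarrow> (nat \<Rightarrow> 'u) \<Rightarrow> nat \<Rightarrow> 'u" where
  "outputs g X n = g (map X [0..<Suc n])"

definition generator :: "('u list \<Rightarrow> 'u) \<Rightarrow> bool" where
  "generator g \<longleftrightarrow>
     (\<forall>X n. outputs g X n \<notin> X ` {..n} \<and> outputs g X n \<notin> outputs g X ` {..<n})"

definition consistent_from :: "('u list \<Rightarrow> 'u) \<Rightarrow> 'u set \<Rightarrow> (nat \<Rightarrow> 'u) \<Rightarrow> nat \<Rightarrow> bool" where
  "consistent_from g K X T \<longleftrightarrow> (\<forall>n\<ge>T. outputs g X n \<in> K)"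

definition eventually_consistent :: "((nat \<Rightarrow> 'u set) \<Rightarrow> 'u list \<Rightarrow> 'u) \<Rightarrow> bool" where
  "eventually_consistent B \<longleftrightarrow>
     (\<forall>L. collection L \<longrightarrow>
        (\<forall>K\<in>range L. \<forall>X\<in>fin_cont K. \<exists>T. consistent_from (B L) K X T))"

(* The properties assumed of the black box: a deterministic generator, given the collection. *)
definition MVYZ_generator :: "(nat \<Rightarrow> 'u) \<Rightarrow> ((nat \<Rightarrow> 'u set) \<Rightarrow> 'u list \<Rightarrow> 'u) \<Rightarrow> bool" where
  "MVYZ_generator u B \<longleftrightarrow>
     (\<forall>L. collection L \<longrightarrow> generator (B L)) \<and>
     eventually_consistent B \<and>
     (\<forall>L. collection L \<longrightarrow> (\<forall>K\<in>range L. \<forall>X\<in>fin_cont K.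
        liminf (\<lambda>i. ereal (real (card (range (outputs (B L) X) \<inter> listing u K ` {..<i})) / real i))
          \<ge> 1/2))"

(* Internal randomness is a seed drawn once from M; every realisation obeys the output rule. *)
definition randomized_generator :: "'r measure \<Rightarrow> ('r \<Rightarrow> 'u list \<Rightarrow> 'u) \<Rightarrow> bool" where
  "randomized_generator M A \<longleftrightarrow>
     prob_space M \<and>
     (\<forall>h. (\<lambda>r. A r h) \<in> measurable M (count_space UNIV)) \<and>
     (\<forall>r\<in>space M. generator (A r))"


section \<open>Black-box access\<close>

(* A terminating computation that may interact with an oracle only by submitting queries and
   continuing according to the answers; each run makes finitely many queries. *)
datatype ('q, 'a, 'o) oracle_prog =
    Return 'o
  | Call 'q "'a \<Rightarrow> ('q, 'a, 'o) oracle_prog"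

primrec run :: "('q \<Rightarrow> 'a) \<Rightarrow> ('q, 'a, 'o) oracle_prog \<Rightarrow> 'o" where
  "run b (Return y) = y"
| "run b (Call q k) = run b (k (b q))"

(* The program P knows the collection, the seed and the history, but sees B only through its
   answers (on arbitrary finite histories, for the same collection). *)
definition with_black_box ::
  "((nat \<Rightarrow> 'u set) \<Rightarrow> 'r \<Rightarrow> 'u list \<Rightarrow> ('u list, 'u, 'u) oracle_prog) \<Rightarrow>
   ((nat \<Rightarrow> 'u set) \<Rightarrow> 'u list \<Rightarrow> 'u) \<Rightarrow> (nat \<Rightarrow> 'u set) \<Rightarrow> 'r \<Rightarrow> 'u list \<Rightarrow> 'u" where
  "with_black_box P B L r h = run (B L) (P L r h)"


section \<open>Hallucination rate, density with deadlines, feasible profiles\<close>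

(* A bound on this rate by a null sequence cannot hold from a time that is the same for all K and X:
   the first t observations may be noise, and with all u-tails in the collection K may avoid the
   first t outputs.  The time from which a bound holds has to depend on when the black box becomes
   consistent (consistent_from) on the given K and X. *)
definition hallucination_rate ::
  "'r measure \<Rightarrow> ('r \<Rightarrow> 'u list \<Rightarrow> 'u) \<Rightarrow> 'u set \<Rightarrow> (nat \<Rightarrow> 'u) \<Rightarrow> nat \<Rightarrow> real" where
  "hallucination_rate M A K X t =
     (\<integral>r. real (card (outputs (A r) X ` {..<t} - K)) / real t \<partial>M)"

definition mu :: "nat \<Rightarrow> (nat \<Rightarrow> 'u) \<Rightarrow> (nat \<Rightarrow> 'u) \<Rightarrow> (nat \<Rightarrow> nat) \<Rightarrow> real" where
  "mu i S R D = (\<Sum>j = 1..i. of_bool (R (j - 1) \<in> S ` {..<D j})) / real i"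

definition D_inv :: "(nat \<Rightarrow> nat) \<Rightarrow> nat \<Rightarrow> nat" where
  "D_inv D t = (LEAST n. 1 \<le> n \<and> t \<le> D n)"

definition feasible_profile :: "(nat \<Rightarrow> nat) \<Rightarrow> (nat \<Rightarrow> real) \<Rightarrow> bool" where
  "feasible_profile D H \<longleftrightarrow>
     mono_on {1..} D \<and>
     (\<forall>n\<ge>1. int (D (n + 1)) - int (D n) \<le> int (D (n + 2)) - int (D (n + 1))) \<and>
     filterlim (\<lambda>n. real (D n) / real n) at_top sequentially \<and>
     (\<forall>t\<ge>1. 0 \<le> H t) \<and>
     antimono_on {1..} H \<and>
     H \<longlonglongrightarrow> 0 \<and>
     H \<in> \<omega>(\<lambda>t. real (D_inv D t) / real t)"

end

theory Submission
  imports Defs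
begin

text \<open>The generator follows the proposals \<open>y n\<close> of the black box, except at explore times. For every
  \<open>j\<close> and every \<open>i < m j\<close>, where \<open>m\<close> is unbounded but grows slowly, a slot inside the window
  \<open>{D j..<D (Suc j)}\<close> contains one uniformly random explore time, at which the \<open>j\<close>-th element
  (counted from 0) of the \<open>i\<close>-th language is output. By convexity and superlinearity of \<open>D\<close> the windows
  become arbitrarily long, so \<open>m\<close> can be chosen such that the slots do too, while at
  most \<open>t * H t / 2\<close> of them start before a large time \<open>t\<close>. An element of \<open>K\<close> proposed before
  its deadline is output in time unless it is proposed at an explore time; one proposed later is unobserved until its
  deadline, and hence output in time by exploration. The black box and the observations do not see
  the explore times, so by Hoeffding's inequality and Borel--Cantelli almost surely only a vanishing
  fraction of the proposals is lost.\<close>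

section \<open>Exploration slots from a feasible profile\<close>

text \<open>Diagonal choice: \<open>m d\<close> is the largest \<open>C \<le> d\<close> such that
  \<open>P C\<close> holds at every point from \<open>d\<close> on. The cap \<open>d\<close> keeps
  the candidates finite, \<open>P 0\<close> provides one, and a candidate at \<open>d\<close>
  remains one later, which gives monotonicity.\<close>

lemma slow_unbounded:
  fixes P :: "nat \<Rightarrow> nat \<Rightarrow> bool"
  assumes ev: "\<And>C. \<forall>\<^sub>F d in sequentially. P C d" and zero: "\<And>d. P 0 d"
  obtains m where "mono m" "\<And>d. P (m d) d" "filterlim m at_top sequentially"
proof
  define A where "A d = {C. C \<le> d \<and> (\<forall>d'\<ge>d. P C d')}" for d
  define m where "m d = Max (A d)" for d
  have fin: "finite (A d)" for d
    by (rule finite_subset[of _ "{..d}"]) (auto simp: A_def)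
  have in_A: "m d \<in> A d" for d
    unfolding m_def by (rule Max_in) (use fin zero in \<open>auto simp: A_def\<close>)
  have ge: "C \<le> m d" if "C \<in> A d" for C d
    unfolding m_def using that fin by simp
  show "mono m"
  proof (rule monoI)
    fix d d' :: nat assume "d \<le> d'"
    then have "m d \<in> A d'" using in_A[of d] by (auto simp: A_def)
    then show "m d \<le> m d'" by (rule ge)
  qed
  show "P (m d) d" for d using in_A[of d] by (auto simp: A_def)
  show "filterlim m at_top sequentially"
    unfolding filterlim_at_top
  proof
    fix C
    obtain N where N: "\<And>d. d \<ge> N \<Longrightarrow> P C d"
      using ev[of C] by (auto simp: eventually_sequentially)
    have "C \<le> m d" if "d \<ge> max C N" for d
      by (rule ge) (use that N in \<open>auto simp: A_def\<close>)
    then show "\<forall>\<^sub>F d in sequentially. C \<le> m d"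
      unfolding eventually_sequentially by blast
  qed
qed

section \<open>Growth and budget consequences of feasibility\<close>

lemma feasible_mono: "feasible_profile D H \<Longrightarrow> 1 \<le> i \<Longrightarrow> i \<le> j \<Longrightarrow> D i \<le> D j"
  by (auto simp: feasible_profile_def mono_on_def)

lemma feasible_D_large:
  assumes "feasible_profile D H"
  shows "\<forall>\<^sub>F n in sequentially. C * n \<le> D n"
proof -
  have "\<forall>\<^sub>F n in sequentially. real C \<le> real (D n) / real n"
    using assms by (auto simp: feasible_profile_def filterlim_at_top)
  then show ?thesis using eventually_gt_at_top[of 0]
  proof eventually_elim
    case (elim n)
    then have "real (C * n) \<le> real (D n)" by (simp add: field_simps)
    then show ?case by (simp only: of_nat_le_iff)
  qed
qed

text \<open>Convexity makes the increments nondecreasing. If they all stayed below \<open>C\<close>,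
  \<open>D\<close> would grow at most linearly, against superlinearity.\<close>

lemma feasible_increments:
  assumes "feasible_profile D H"
  shows "\<forall>\<^sub>F n in sequentially. C \<le> D (Suc n) - D n"
proof -
  define \<Delta> where "\<Delta> n = D (Suc n) - D n" for n
  have D_Suc: "D (Suc n) = D n + \<Delta> n" if "n \<ge> 1" for n
    using feasible_mono[OF assms that, of "Suc n"] by (simp add: \<Delta>_def)
  have \<Delta>_Suc: "\<Delta> n \<le> \<Delta> (Suc n)" if "n \<ge> 1" for n
  proof -
    have "int (D (n + 1)) - int (D n) \<le> int (D (n + 2)) - int (D (n + 1))"
      using assms that by (auto simp: feasible_profile_def)
    then show ?thesis using D_Suc[OF that] D_Suc[of "Suc n"] by simp
  qed
  have \<Delta>_mono: "\<Delta> n \<le> \<Delta> n'" if "1 \<le> n" "n \<le> n'" for n n'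
    using that(2)
  proof (induction n' rule: dec_induct)
    case (step k)
    then show ?case using \<Delta>_Suc[of k] that(1) by simp
  qed simp
  have "\<exists>n\<ge>1. C \<le> \<Delta> n"
  proof (rule ccontr)
    assume neg: "\<not> ?thesis"
    have bound: "D n \<le> D 1 + C * n" if "n \<ge> 1" for n
      using that
    proof (induction n rule: dec_induct)
      case (step n)
      then have "\<Delta> n \<le> C" using neg by (meson linear)
      then show ?case using step \<open>n \<ge> 1\<close> D_Suc[of n] by simp
    qed simp
    obtain n where "n > D 1 + 1" "(C + 1) * n \<le> D n"
      using eventually_happens[OF eventually_conj[OF feasible_D_large[OF assms, of "C + 1"]
          eventually_gt_at_top[of "D 1 + 1"]]] by auto
    then show False using bound[of n] by simp
  qed
  then obtain n where "n \<ge> 1" "C \<le> \<Delta> n" by blast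
  then have "C \<le> \<Delta> n'" if "n' \<ge> n" for n' using \<Delta>_mono[of n n'] that by simp
  then show ?thesis unfolding eventually_sequentially \<Delta>_def by blast
qed

text \<open>Superlinearity makes the \<open>LEAST\<close> in \<open>D_inv\<close> attained, and
  monotonicity does the rest. This later bounds the stage of every slot that starts before
  \<open>t\<close>.\<close>

lemma feasible_less_D_inv:
  assumes "feasible_profile D H" and "D j < t" "1 \<le> j"
  shows "j < D_inv D t"
proof -
  obtain n where "n \<ge> max 1 t" "1 * n \<le> D n"
    using eventually_happens[OF eventually_conj[OF feasible_D_large[OF assms(1), of 1]
          eventually_ge_at_top[of "max 1 t"]]] by auto
  then have "\<exists>n. 1 \<le> n \<and> t \<le> D n" by (intro exI[of _ n]) auto
  then have *: "1 \<le> D_inv D t \<and> t \<le> D (D_inv D t)" unfolding D_inv_def by (rule LeastI_ex)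
  show ?thesis
  proof (rule ccontr)
    assume "\<not> ?thesis"
    then show False using feasible_mono[OF assms(1), of "D_inv D t" j] * assms by simp
  qed
qed

lemma feasible_budget:
  assumes "feasible_profile D H"
  shows "\<forall>\<^sub>F t in sequentially. C * real (D_inv D t) \<le> real t * H t"
proof -
  have "H \<in> \<omega>(\<lambda>t. real (D_inv D t) / real t)" and nonneg: "\<And>t. t \<ge> 1 \<Longrightarrow> 0 \<le> H t"
    using assms by (auto simp: feasible_profile_def)
  then have "\<forall>\<^sub>F t in sequentially. \<bar>H t\<bar> \<ge> (\<bar>C\<bar> + 1) * \<bar>real (D_inv D t) / real t\<bar>"
    using landau_omega.smallD[of H sequentially "\<lambda>t. real (D_inv D t) / real t" "\<bar>C\<bar> + 1"]
    by simp
  then show ?thesis using eventually_ge_at_top[of 1]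
  proof eventually_elim
    case (elim t)
    have "C * real (D_inv D t) \<le> (\<bar>C\<bar> + 1) * real (D_inv D t)"
      by (intro mult_right_mono) auto
    also have "\<dots> \<le> real t * H t"
      using elim nonneg[of t] by (simp add: field_simps)
    finally show ?case .
  qed
qed

text \<open>Once \<open>t\<close> exceeds \<open>D 1\<close>, \<open>D_inv D t\<close> is positive,
  so the budget \<open>t * H t\<close> tends to infinity. It can thus pay for any fixed initial
  period in which the black box errs.\<close>

lemma feasible_budget_at_top:
  assumes "feasible_profile D H"
  shows "\<forall>\<^sub>F t in sequentially. C \<le> real t * H t"
  using feasible_budget[OF assms, of "\<bar>C\<bar>"] eventually_gt_at_top[of "D 1"]
proof eventually_elim
  case (elim t)
  have "\<bar>C\<bar> * 1 \<le> \<bar>C\<bar> * real (D_inv D t)"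
    using feasible_less_D_inv[OF assms elim(2)] by (intro mult_left_mono) auto
  then show ?case using elim by simp
qed

text \<open>The budget bound is reindexed by the stage \<open>d\<close>, because the number of slots
  is chosen per stage. Times up to \<open>t0\<close> produce only finitely many values of
  \<open>D_inv\<close>, so a larger \<open>d\<close> arises only from times beyond
  \<open>t0\<close>.\<close>

lemma feasible_budget_uniform:
  assumes "feasible_profile D H"
  shows "\<forall>\<^sub>F d in sequentially. \<forall>t. D_inv D t = d \<longrightarrow> C * real d \<le> real t * H t"
proof -
  obtain t0 where t0: "\<And>t. t \<ge> t0 \<Longrightarrow> C * real (D_inv D t) \<le> real t * H t"
    using feasible_budget[OF assms, of C] by (auto simp: eventually_sequentially)
  define d0 where "d0 = Max (D_inv D ` {..t0})"
  have "C * real d \<le> real t * H t" if "d > d0" "D_inv D t = d" for d t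
  proof -
    have "t > t0"
    proof (rule ccontr)
      assume "\<not> ?thesis"
      then have "D_inv D t \<le> d0" unfolding d0_def by (intro Max_ge) auto
      then show False using that by simp
    qed
    then show ?thesis using t0[of t] that by simp
  qed
  then show ?thesis by (intro eventually_mono[OF eventually_gt_at_top[of d0]]) simp
qed

text \<open>Condition \<open>long\<close> is what makes exploration cheap: a uniform time in a slot
  of length at least \<open>C\<close> equals a prescribed time with probability at most
  \<open>1 / C\<close>, and only finitely many slots escape this bound.\<close>

locale slots =
  fixes Q :: "nat set" and s l :: "nat \<Rightarrow> nat"
  assumes pos: "q \<in> Q \<Longrightarrow> 0 < l q"
    and disjoint: "q \<in> Q \<Longrightarrow> q' \<in> Q \<Longrightarrow> n \<in> {s q..<s q + l q} \<Longrightarrow> n \<in> {s q'..<s q' + l q'} \<Longrightarrow> q = q'"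
    and long: "finite {q \<in> Q. l q < C}"

text \<open>A slot is the code of a pair (stage \<open>j\<close>, language \<open>i\<close>) with
  \<open>i < m j\<close>; the \<open>m j\<close> slots of a stage are consecutive blocks of equal
  length in its window. The window ends at \<open>D (Suc j)\<close>, the deadline of the element
  with 0-based index \<open>j\<close>.\<close>

lemma feasible_slots:
  assumes feas: "feasible_profile D H"
  obtains Q s l and lang idx :: "nat \<Rightarrow> nat" where "slots Q s l"
    and "\<And>i. \<forall>\<^sub>F j in sequentially. \<exists>q\<in>Q. lang q = i \<and> idx q = j \<and> s q + l q \<le> D (Suc j)"
    and "\<And>T. \<forall>\<^sub>F t in sequentially. finite {q \<in> Q. s q < t} \<and>
          real (T + card {q \<in> Q. s q < t}) \<le> real t * H t"
proof -
  \<comment> \<open>A window of length \<open>C * C\<close> holds \<open>C\<close> slots of length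
    at least \<open>C\<close>. The factor 2 spends half of the budget \<open>t * H t\<close> on
    slots and leaves the other half for \<open>T\<close>.\<close>
  define P where "P C d \<longleftrightarrow> C * C \<le> D (Suc d) - D d \<and>
    (\<forall>t. D_inv D t = d \<longrightarrow> 2 * real C * real d \<le> real t * H t)" for C d
  have nonneg: "0 \<le> real t * H t" for t
    using feas by (cases t) (auto simp: feasible_profile_def)
  have ev: "\<forall>\<^sub>F d in sequentially. P C d" for C
    unfolding P_def using feasible_increments[OF feas] feasible_budget_uniform[OF feas]
    by (rule eventually_conj)
  have "P 0 d" for d by (simp add: P_def nonneg)
  with ev obtain m where "mono m" and P: "\<And>d. P (m d) d" and m_top: "filterlim m at_top sequentially"
    using slow_unbounded[of P] by blast
  define len where "len j = (D (Suc j) - D j) div m j" for j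
  \<comment> \<open>Stages start at 1 because feasibility constrains \<open>D\<close> only from
    there on.\<close>
  define Q where "Q = {q. 1 \<le> fst (prod_decode q) \<and> snd (prod_decode q) < m (fst (prod_decode q))}"
  define l where "l q = len (fst (prod_decode q))" for q
  define s where "s q = D (fst (prod_decode q)) + snd (prod_decode q) * len (fst (prod_decode q))" for q
  have len_ge: "m j \<le> len j" for j
    using P[of j] unfolding P_def len_def
    by (cases "m j = 0") (auto simp: less_eq_div_iff_mult_less_eq)
  have slot_end: "D j + i * len j + len j \<le> D (Suc j)" if "1 \<le> j" "i < m j" for i j
  proof -
    have "i * len j + len j = Suc i * len j" by simp
    also have "\<dots> \<le> m j * len j" using that by (intro mult_right_mono) auto
    also have "\<dots> \<le> D (Suc j) - D j" by (simp add: len_def)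
    finally show ?thesis using feasible_mono[OF feas that(1), of "Suc j"] by simp
  qed
  have stage: "D (fst (prod_decode q)) \<le> s q" "s q + l q \<le> D (Suc (fst (prod_decode q)))" if "q \<in> Q" for q
    using that slot_end[of "fst (prod_decode q)" "snd (prod_decode q)"] by (auto simp: Q_def s_def l_def)
  show ?thesis
  proof (rule that[of Q s l "\<lambda>q. snd (prod_decode q)" "\<lambda>q. fst (prod_decode q)"])
    show "slots Q s l"
    proof
      fix q assume "q \<in> Q"
      then show "0 < l q" using len_ge[of "fst (prod_decode q)"] by (auto simp: Q_def l_def)
    next
      fix q q' n assume q: "q \<in> Q" "q' \<in> Q" and n: "n \<in> {s q..<s q + l q}" "n \<in> {s q'..<s q' + l q'}"
      have le: "fst (prod_decode a) \<le> fst (prod_decode b)"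
        if "a \<in> Q" "b \<in> Q" "n \<in> {s a..<s a + l a}" "n \<in> {s b..<s b + l b}" for a b
      proof (rule ccontr)
        assume "\<not> ?thesis"
        then have "D (Suc (fst (prod_decode b))) \<le> D (fst (prod_decode a))"
          by (intro feasible_mono[OF feas]) auto
        then show False using stage[OF that(1)] stage[OF that(2)] that(3,4) by simp
      qed
      have fst_eq: "fst (prod_decode q) = fst (prod_decode q')" (is "_ = ?j")
        using le[of q q'] le[of q' q] q n by simp
      have "snd (prod_decode a) \<le> snd (prod_decode b)"
        if "fst (prod_decode a) = ?j" "fst (prod_decode b) = ?j" "n \<in> {s a..<s a + l a}" "n \<in> {s b..<s b + l b}" for a b
      proof (rule ccontr)
        assume "\<not> ?thesis"
        then have "Suc (snd (prod_decode b)) * len ?j \<le> snd (prod_decode a) * len ?j"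
          by (intro mult_right_mono) auto
        then show False using that by (simp add: s_def l_def)
      qed
      from this[of q q'] this[of q' q] have "snd (prod_decode q) = snd (prod_decode q')"
        using n fst_eq by simp
      then show "q = q'" using fst_eq by (metis prod.collapse prod_decode_inverse)
    next
      fix C
      obtain J where J: "\<And>j. j \<ge> J \<Longrightarrow> C \<le> m j"
        using m_top by (auto simp: filterlim_at_top eventually_sequentially)
      have "{q \<in> Q. l q < C} \<subseteq> prod_encode ` (SIGMA j:{..<J}. {..<m j})"
      proof
        fix q assume q: "q \<in> {q \<in> Q. l q < C}"
        then have "m (fst (prod_decode q)) < C" using len_ge[of "fst (prod_decode q)"] by (simp add: l_def)
        then have "fst (prod_decode q) < J" using J[of "fst (prod_decode q)"] by force
        then show "q \<in> prod_encode ` (SIGMA j:{..<J}. {..<m j})"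
          using q by (intro image_eqI[of _ _ "prod_decode q"]) (auto simp: Q_def Sigma_def prod_eq_iff)
      qed
      then show "finite {q \<in> Q. l q < C}" by (rule finite_subset) auto
    qed
  next
    fix i
    show "\<forall>\<^sub>F j in sequentially. \<exists>q\<in>Q. snd (prod_decode q) = i \<and> fst (prod_decode q) = j \<and> s q + l q \<le> D (Suc j)"
      using m_top[unfolded filterlim_at_top, rule_format, of "Suc i"] eventually_ge_at_top[of 1]
    proof eventually_elim
      case (elim j)
      then show ?case using slot_end[of j i]
        by (intro bexI[of _ "prod_encode (j, i)"]) (auto simp: Q_def s_def l_def)
    qed
  next
    fix T :: nat
    show "\<forall>\<^sub>F t in sequentially. finite {q \<in> Q. s q < t} \<and>
          real (T + card {q \<in> Q. s q < t}) \<le> real t * H t"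
      using feasible_budget_at_top[OF feas, of "2 * real T"]
    proof eventually_elim
      case (elim t)
      define d where "d = D_inv D t"
      \<comment> \<open>A slot started before \<open>t\<close> belongs to a stage below
        \<open>d\<close>, and monotonicity of \<open>m\<close> bounds the number of slots of each
        such stage by \<open>m d\<close>.\<close>
      have sub: "{q \<in> Q. s q < t} \<subseteq> prod_encode ` ({..<d} \<times> {..<m d})"
      proof
        fix q assume q: "q \<in> {q \<in> Q. s q < t}"
        have "fst (prod_decode q) < d" unfolding d_def
          by (rule feasible_less_D_inv[OF feas]) (use q stage[of q] in \<open>auto simp: Q_def\<close>)
        moreover from this have "m (fst (prod_decode q)) \<le> m d" using \<open>mono m\<close> by (simp add: monoD)
        ultimately show "q \<in> prod_encode ` ({..<d} \<times> {..<m d})"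
          using q by (intro image_eqI[of _ _ "prod_decode q"]) (auto simp: Q_def mem_Times_iff)
      qed
      have "card {q \<in> Q. s q < t} \<le> card (prod_encode ` ({..<d} \<times> {..<m d}))"
        by (intro card_mono sub) auto
      also have "\<dots> \<le> d * m d" by (rule order.trans[OF card_image_le]) (auto simp: card_cartesian_product)
      finally have "real (card {q \<in> Q. s q < t}) \<le> real (m d) * real d"
        by (metis mult.commute of_nat_le_iff of_nat_mult)
      moreover have "2 * real (m d) * real d \<le> real t * H t" using P[of d] by (simp add: P_def d_def)
      ultimately show ?case using elim finite_subset[OF sub] by simp
    qed
  qed
qed

section \<open>Mixing black-box proposals with exploration\<close>

definition avoid :: "(nat \<Rightarrow> 'u) \<Rightarrow> 'u set \<Rightarrow> 'u \<Rightarrow> 'u" where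
  "avoid u S c = (if c \<in> S then u (LEAST m. u m \<notin> S) else c)"

lemma avoid_notin:
  assumes "inj u" "finite S"
  shows "avoid u S c \<notin> S"
proof -
  have "\<not> range u \<subseteq> S" using assms finite_subset range_inj_infinite by blast
  then have "\<exists>m. u m \<notin> S" by auto
  then have "u (LEAST m. u m \<notin> S) \<notin> S" by (rule LeastI_ex)
  then show ?thesis by (simp add: avoid_def)
qed

text \<open>A candidate that has not been observed can only be blocked by having been output
  already, so in either case it is among the outputs by time \<open>n\<close>.\<close>

lemma avoid_image:
  fixes o' :: "nat \<Rightarrow> 'u"
  assumes "o' n = avoid u (o' ` {..<n} \<union> S) c" "c \<notin> S"
  shows "c \<in> o' ` {..n}"
proof (cases "c \<in> o' ` {..<n}")
  case False
  then have "o' n = c" using assms by (simp add: avoid_def)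
  then show ?thesis by blast
qed auto

text \<open>Here \<open>e\<close> marks the explore times, \<open>w\<close> supplies the elements to
  explore and \<open>y\<close> the proposals of the black box. The whole list is carried along
  because each output must avoid all earlier ones.\<close>

primrec mix :: "(nat \<Rightarrow> 'u) \<Rightarrow> (nat \<Rightarrow> bool) \<Rightarrow> (nat \<Rightarrow> 'u) \<Rightarrow> (nat \<Rightarrow> 'u) \<Rightarrow> (nat \<Rightarrow> 'u) \<Rightarrow> nat \<Rightarrow> 'u list" where
  "mix u e w y X 0 = []"
| "mix u e w y X (Suc n) = mix u e w y X n @
     [avoid u (set (mix u e w y X n) \<union> X ` {..n}) (if e n then w n else y n)]"

lemma length_mix [simp]: "length (mix u e w y X n) = n"
  by (induction n) auto

lemma set_mix: "set (mix u e w y X n) = (\<lambda>k. last (mix u e w y X (Suc k))) ` {..<n}"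
  by (induction n) (auto simp: lessThan_Suc)

text \<open>Causality: it allows the finite history seen by the program to be exchanged for the
  infinite sequences.\<close>

lemma mix_cong:
  "(\<And>k. k < n \<Longrightarrow> y k = y' k) \<Longrightarrow> (\<And>k. k < n \<Longrightarrow> X k = X' k) \<Longrightarrow>
   mix u e w y X n = mix u e w y' X' n"
proof (induction n)
  case (Suc n)
  then have "X ` {..n} = X' ` {..n}" by (intro image_cong) auto
  with Suc show ?case by simp
qed simp

text \<open>The arbitrary \<open>F\<close> carries the induction: after the case split on
  \<open>e r n\<close>, appending an entry is just another function of the shorter list.\<close>

lemma measurable_mix:
  assumes "\<And>n. Measurable.pred M (\<lambda>r. e r n)"
  shows "(\<lambda>r. F (mix u (e r) w y X n)) \<in> measurable M (count_space UNIV)"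
proof (induction n arbitrary: F)
  case (Suc n)
  let ?G = "\<lambda>c xs. F (xs @ [avoid u (set xs \<union> X ` {..n}) c])"
  have "(\<lambda>r. F (mix u (e r) w y X (Suc n))) =
      (\<lambda>r. if e r n then ?G (w n) (mix u (e r) w y X n) else ?G (y n) (mix u (e r) w y X n))"
    by auto
  moreover have "\<dots> \<in> measurable M (count_space UNIV)"
    by (rule measurable_If[OF Suc.IH Suc.IH]) (use assms in \<open>simp add: pred_def\<close>)
  ultimately show ?case by simp
qed simp

section \<open>The mixture as a black-box program\<close>

primrec query_all :: "'q list \<Rightarrow> ('a list \<Rightarrow> 'o) \<Rightarrow> ('q, 'a, 'o) oracle_prog" where
  "query_all [] f = Return (f [])"
| "query_all (q # qs) f = Call q (\<lambda>a. query_all qs (\<lambda>as. f (a # as)))"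

lemma run_query_all: "run b (query_all qs f) = f (map b qs)"
  by (induction qs arbitrary: f) auto

text \<open>A generator keeps no state between calls, so the program queries the black box on every
  nonempty prefix of \<open>h\<close>, replays the whole run and returns its last output.\<close>

definition mix_prog ::
  "(nat \<Rightarrow> 'u) \<Rightarrow> (nat \<Rightarrow> bool) \<Rightarrow> (nat \<Rightarrow> 'u) \<Rightarrow> 'u list \<Rightarrow> ('u list, 'u, 'u) oracle_prog" where
  "mix_prog u e w h = query_all (map (\<lambda>k. take (Suc k) h) [0..<length h])
     (\<lambda>ys. last (mix u e w ((!) ys) ((!) h) (length h)))"

lemma run_mix_prog:
  "run b (mix_prog u e w h) =
     last (mix u e w ((!) (map (\<lambda>k. b (take (Suc k) h)) [0..<length h])) ((!) h) (length h))"
  by (simp add: mix_prog_def run_query_all comp_def)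

lemma outputs_mix_prog:
  "outputs (\<lambda>h. run b (mix_prog u e w h)) X n = last (mix u e w (outputs b X) X (Suc n))"
proof -
  have "take (Suc k) (map X [0..<Suc n]) = map X [0..<Suc k]" if "k < Suc n" for k
    using that by (simp only: take_map take_upt add_0)
  then have "mix u e w ((!) (map (\<lambda>k. b (take (Suc k) (map X [0..<Suc n]))) [0..<Suc n]))
      ((!) (map X [0..<Suc n])) (Suc n) = mix u e w (outputs b X) X (Suc n)"
    by (intro mix_cong) (simp_all only: nth_map nth_upt length_upt diff_zero add_0 outputs_def)
  then show ?thesis
    by (subst outputs_def) (simp only: run_mix_prog length_map length_upt diff_zero)
qed

lemma outputs_mix_prog_rec:
  fixes u :: "nat \<Rightarrow> 'u" and e w b X and o' :: "nat \<Rightarrow> 'u"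
  defines "o' \<equiv> outputs (\<lambda>h. run b (mix_prog u e w h)) X"
  shows "o' n = avoid u (o' ` {..<n} \<union> X ` {..n}) (if e n then w n else outputs b X n)"
  unfolding o'_def outputs_mix_prog set_mix[symmetric] by simp

lemma generator_mix_prog:
  assumes "inj u"
  shows "generator (\<lambda>h. run b (mix_prog u e w h))"
  unfolding generator_def
proof (intro allI)
  fix X n
  let ?o = "outputs (\<lambda>h. run b (mix_prog u e w h)) X"
  have "?o n \<notin> ?o ` {..<n} \<union> X ` {..n}"
    unfolding outputs_mix_prog_rec[of b u e w X n] by (rule avoid_notin[OF assms]) auto
  then show "?o n \<notin> X ` {..n} \<and> ?o n \<notin> ?o ` {..<n}" by simp
qed

lemma generator_inj:
  assumes "generator g"
  shows "inj (outputs g X)"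
proof (rule linorder_injI)
  fix m n :: nat assume "m < n"
  moreover have "outputs g X n \<notin> outputs g X ` {..<n}" using assms by (simp add: generator_def)
  ultimately show "outputs g X m \<noteq> outputs g X n" by (metis imageI lessThan_iff)
qed

text \<open>A fallback output is forced by an earlier output of \<open>o'\<close> that anticipated the value \<open>y n\<close>.
  From time \<open>T\<close> on this value lies in \<open>K\<close>, so fallbacks outside \<open>K\<close> are paid for by outputs
  in \<open>K\<close> that did not follow \<open>y\<close>, and chains of fallbacks cost nothing.\<close>

lemma hallucination_count:
  fixes y o' :: "nat \<Rightarrow> 'u"
  assumes "inj y" and follow: "\<And>n. \<not> e n \<Longrightarrow> y n \<notin> o' ` {..<n} \<Longrightarrow> o' n = y n"
    and cons: "\<And>n. n \<ge> T \<Longrightarrow> y n \<in> K"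
  shows "card (o' ` {..<t} - K) \<le> T + card {n. n < t \<and> e n}"
proof -
  \<comment> \<open>Roles: \<open>N\<close> collects the departures from \<open>y\<close>,
    \<open>C\<close> those that are forced fallbacks after \<open>T\<close>, and \<open>NK\<close>
    the departures into \<open>K\<close> that pay for \<open>C\<close>.\<close>
  define N where "N = {n. n < t \<and> o' n \<noteq> y n}"
  define C where "C = {n. T \<le> n \<and> n < t \<and> \<not> e n \<and> o' n \<noteq> y n}"
  define NK where "NK = {n \<in> N. o' n \<in> K}"
  have fin: "finite N" "finite C" "finite NK" by (auto simp: N_def C_def NK_def)
  have "\<exists>m<n. o' m = y n" if "n \<in> C" for n
  proof -
    have "y n \<in> o' ` {..<n}" using that follow by (auto simp: C_def)
    then show ?thesis by force
  qed
  then obtain f where f: "\<And>n. n \<in> C \<Longrightarrow> f n < n \<and> o' (f n) = y n" by metis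
  have "inj_on f C" by (rule inj_onI) (metis f injD[OF \<open>inj y\<close>])
  moreover have "f ` C \<subseteq> NK"
  proof
    fix m assume "m \<in> f ` C"
    then obtain n where n: "n \<in> C" "m = f n" by blast
    with f[of n] have "m < n" "o' m = y n" by auto
    \<comment> \<open>Injectivity of \<open>y\<close> separates \<open>y m\<close> from
      \<open>y n\<close>, so time \<open>m\<close> is itself a departure from the proposals.\<close>
    moreover from this have "o' m \<noteq> y m" using injD[OF \<open>inj y\<close>, of m n] by auto
    ultimately show "m \<in> NK" using n cons by (auto simp: NK_def N_def C_def)
  qed
  ultimately have CNK: "card C \<le> card NK" using fin by (metis card_inj_on_le)
  have CN: "C \<subseteq> N" by (auto simp: C_def N_def)
  have "card (o' ` {..<t} - K) \<le> card (o' ` {n. n < t \<and> o' n \<notin> K})"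
    by (intro card_mono) auto
  also have "\<dots> \<le> card {n. n < t \<and> o' n \<notin> K}" by (rule card_image_le) simp
  also have "\<dots> \<le> card ((N - NK) \<union> {n. n < T \<and> o' n = y n})"
  proof (rule card_mono)
    show "{n. n < t \<and> o' n \<notin> K} \<subseteq> (N - NK) \<union> {n. n < T \<and> o' n = y n}"
      using cons by (auto simp: N_def NK_def not_le[symmetric])
  qed (use fin in simp)
  also have "\<dots> \<le> card (N - NK) + card {n. n < T \<and> o' n = y n}" by (rule card_Un_le)
  also have "card (N - NK) = card N - card NK" by (intro card_Diff_subset) (auto simp: fin NK_def)
  \<comment> \<open>The exchange: departures into \<open>K\<close> are at least as numerous as the
    fallbacks in \<open>C\<close>, so \<open>C\<close> may be removed from \<open>N\<close> instead.
    What is left is early or exploratory.\<close>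
  also have "\<dots> \<le> card N - card C" using CNK by simp
  also have "\<dots> = card (N - C)" using CN fin by (simp add: card_Diff_subset)
  also have "\<dots> \<le> card ({n. n < T \<and> o' n \<noteq> y n} \<union> {n. n < t \<and> e n})"
    by (intro card_mono) (auto simp: N_def C_def)
  also have "\<dots> \<le> card {n. n < T \<and> o' n \<noteq> y n} + card {n. n < t \<and> e n}" by (rule card_Un_le)
  finally have "card (o' ` {..<t} - K) \<le>
      (card {n. n < T \<and> o' n \<noteq> y n} + card {n. n < T \<and> o' n = y n}) + card {n. n < t \<and> e n}"
    by simp
  also have "card {n. n < T \<and> o' n \<noteq> y n} + card {n. n < T \<and> o' n = y n} =
      card ({n. n < T \<and> o' n \<noteq> y n} \<union> {n. n < T \<and> o' n = y n})"
    by (rule card_Un_disjoint[symmetric]) auto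
  also have "{n. n < T \<and> o' n \<noteq> y n} \<union> {n. n < T \<and> o' n = y n} = {..<T}" by auto
  finally show ?thesis by simp
qed

section \<open>From black-box density to density with deadlines\<close>

lemma inj_listing:
  assumes "bij u" "infinite K"
  shows "inj (listing u K)"
proof -
  have "infinite {m. u m \<in> K}"
  proof
    assume "finite {m. u m \<in> K}"
    then have "finite (u ` {m. u m \<in> K})" by simp
    moreover have "u ` {m. u m \<in> K} = K" using bij_is_surj[OF assms(1)] by auto
    ultimately show False using assms(2) by simp
  qed
  then have "inj (enumerate {m. u m \<in> K})" using inj_enumerate by blast
  then show ?thesis
    using bij_is_inj[OF assms(1)] unfolding listing_def by (auto simp: inj_def)
qed

text \<open>Apart from the first \<open>J\<close> indices and the exceptional set \<open>Z\<close>,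
  every listed element of \<open>R\<close> is hit in time. In the application \<open>R\<close> is
  the set of proposals and \<open>Z\<close> consists of those made at explore times.\<close>

lemma mu_lower_bound:
  assumes "inj \<kappa>" "0 < i"
    and hit: "\<And>j. J \<le> j \<Longrightarrow> \<kappa> j \<in> R \<Longrightarrow> \<kappa> j \<in> S ` {..<D (Suc j)} \<or> \<kappa> j \<in> Z"
  shows "real (card (R \<inter> \<kappa> ` {..<i})) / real i - real (J + card (Z \<inter> \<kappa> ` {..<i})) / real i
    \<le> mu i S \<kappa> D"
proof -
  let ?G = "{j. j < i \<and> \<kappa> j \<in> S ` {..<D (Suc j)}}"
  \<comment> \<open>The shift from 1-based positions in \<open>mu\<close> to 0-based listing indices
    turns the deadline \<open>D j\<close> into \<open>D (Suc j)\<close>.\<close>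
  have "(\<Sum>j = 1..i. of_bool (\<kappa> (j - 1) \<in> S ` {..<D j})) =
      (\<Sum>j<i. of_bool (\<kappa> j \<in> S ` {..<D (Suc j)}) :: real)"
    by (rule sum.reindex_bij_witness[of _ Suc "\<lambda>j. j - 1"]) auto
  also have "\<dots> = real (card ?G)"
    by (simp add: sum.inter_filter[symmetric] of_bool_def lessThan_def)
  finally have mu: "mu i S \<kappa> D = real (card ?G) / real i" by (simp add: mu_def)
  have "R \<inter> \<kappa> ` {..<i} \<subseteq> \<kappa> ` {..<J} \<union> (Z \<inter> \<kappa> ` {..<i}) \<union> \<kappa> ` ?G"
  proof
    fix x assume "x \<in> R \<inter> \<kappa> ` {..<i}"
    then obtain j where j: "x = \<kappa> j" "j < i" "\<kappa> j \<in> R" by blast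
    then show "x \<in> \<kappa> ` {..<J} \<union> (Z \<inter> \<kappa> ` {..<i}) \<union> \<kappa> ` ?G"
      using hit[of j] by (cases "J \<le> j") auto
  qed
  then have "card (R \<inter> \<kappa> ` {..<i}) \<le> card (\<kappa> ` {..<J} \<union> (Z \<inter> \<kappa> ` {..<i}) \<union> \<kappa> ` ?G)"
    by (intro card_mono) auto
  also have "\<dots> \<le> card (\<kappa> ` {..<J}) + card (Z \<inter> \<kappa> ` {..<i}) + card (\<kappa> ` ?G)"
    by (intro card_Un_le[THEN order.trans] add_mono) auto
  also have "\<dots> \<le> J + card (Z \<inter> \<kappa> ` {..<i}) + card ?G"
    using card_image_le[of "{..<J}" \<kappa>] card_image_le[of ?G \<kappa>] by simp
  finally have "real (card (R \<inter> \<kappa> ` {..<i})) \<le> real (J + card (Z \<inter> \<kappa> ` {..<i})) + real (card ?G)"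
    by (simp only: of_nat_add[symmetric] of_nat_le_iff)
  then have "real (card (R \<inter> \<kappa> ` {..<i})) / real i
      \<le> (real (J + card (Z \<inter> \<kappa> ` {..<i})) + real (card ?G)) / real i"
    by (intro divide_right_mono) auto
  then show ?thesis unfolding mu by (simp only: add_divide_distrib diff_le_eq add.commute)
qed

lemma Liminf_ge_perturb:
  fixes a b c :: "nat \<Rightarrow> real"
  assumes a: "liminf (\<lambda>i. ereal (a i)) \<ge> ereal \<rho>" and b: "b \<longlonglongrightarrow> 0"
    and le: "\<forall>\<^sub>F i in sequentially. a i - b i \<le> c i"
  shows "liminf (\<lambda>i. ereal (c i)) \<ge> ereal \<rho>"
proof (rule ereal_le_epsilon2)
    fix \<epsilon> :: real assume "\<epsilon> > 0"
    have "ereal (\<rho> - \<epsilon> / 2) < ereal \<rho>" using \<open>\<epsilon> > 0\<close> by simp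
    then have "\<forall>\<^sub>F i in sequentially. ereal (\<rho> - \<epsilon> / 2) < ereal (a i)"
      using a unfolding le_Liminf_iff by blast
    moreover have "\<forall>\<^sub>F i in sequentially. b i < \<epsilon> / 2"
      using order_tendstoD(2)[OF b, of "\<epsilon> / 2"] \<open>\<epsilon> > 0\<close> by simp
    ultimately have "\<forall>\<^sub>F i in sequentially. ereal (\<rho> - \<epsilon>) \<le> ereal (c i)"
      using le by eventually_elim simp
    then have "ereal (\<rho> - \<epsilon>) \<le> liminf (\<lambda>i. ereal (c i))" by (rule Liminf_bounded)
    then have "ereal (\<rho> - \<epsilon>) + ereal \<epsilon> \<le> liminf (\<lambda>i. ereal (c i)) + ereal \<epsilon>" by (rule add_right_mono)
    then show "ereal \<rho> \<le> liminf (\<lambda>i. ereal (c i)) + ereal \<epsilon>" by simp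
qed

section \<open>Random explore times\<close>

context slots
begin

definition offsets :: "(nat \<Rightarrow> real) measure" where
  "offsets = (\<Pi>\<^sub>M q\<in>UNIV. measure_pmf (map_pmf real (pmf_of_set {..<l q})))"

text \<open>The reduction modulo \<open>l q\<close> keeps the time of a slot in \<open>Q\<close>
  inside that slot for every seed, not merely almost surely; on the support of
  \<open>offsets\<close> it changes nothing for such a slot.\<close>

definition tau :: "(nat \<Rightarrow> real) \<Rightarrow> nat \<Rightarrow> nat" where
  "tau r q = s q + nat \<lfloor>r q\<rfloor> mod l q"

definition explore :: "(nat \<Rightarrow> real) \<Rightarrow> nat \<Rightarrow> bool" where
  "explore r n \<longleftrightarrow> (\<exists>q\<in>Q. tau r q = n)"

lemma prob_space_offsets: "prob_space offsets"
  unfolding offsets_def by (intro prob_space_PiM measure_pmf.prob_space_axioms)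

lemma space_offsets [simp]: "space offsets = UNIV"
  by (simp add: offsets_def space_PiM)

lemma measurable_component_offsets [measurable]:
  "(\<lambda>r. f (r q)) \<in> measurable offsets (count_space UNIV)"
proof -
  have "(\<lambda>r. r q) \<in> measurable offsets (measure_pmf (map_pmf real (pmf_of_set {..<l q})))"
    unfolding offsets_def by (rule measurable_component_singleton) simp
  then show ?thesis by (rule measurable_compose) simp
qed

lemma tau_mem: "q \<in> Q \<Longrightarrow> tau r q \<in> {s q..<s q + l q}"
  using pos[of q] by (simp add: tau_def)

lemma measurable_explore: "Measurable.pred offsets (\<lambda>r. explore r n)"
  unfolding explore_def tau_def by measurable

lemma card_explore_le:
  assumes "finite {q \<in> Q. s q < t}"
  shows "card {n. n < t \<and> explore r n} \<le> card {q \<in> Q. s q < t}"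
proof -
  have "{n. n < t \<and> explore r n} \<subseteq> tau r ` {q \<in> Q. s q < t}"
    using tau_mem[of _ r] by (fastforce simp: explore_def)
  then show ?thesis using assms by (meson card_image_le card_mono finite_imageI le_trans)
qed

lemma indep_component_offsets:
  "prob_space.indep_vars offsets (\<lambda>_. borel) (\<lambda>q r. f q (r q) :: real) I"
proof (cases "I = {}")
  case True
  interpret prob_space offsets by (rule prob_space_offsets)
  show ?thesis using True by (simp add: indep_vars_def indep_sets_def)
next
  case False
  interpret prob_space offsets by (rule prob_space_offsets)
  let ?M = "\<lambda>q. measure_pmf (map_pmf real (pmf_of_set {..<l q}))"
  have comp: "(\<lambda>r. r q) \<in> measurable offsets (?M q)" for q
    unfolding offsets_def by (rule measurable_component_singleton) simp
  have "indep_vars ?M (\<lambda>q r. r q) I"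
  proof (subst indep_vars_iff_distr_eq_PiM[OF False comp])
    \<comment> \<open>Independence as equality of laws: the marginal of the product on
      \<open>I\<close> is the product of the factors, and each factor is the law of its
      coordinate.\<close>
    have "distr offsets (\<Pi>\<^sub>M q\<in>I. ?M q) (\<lambda>r. \<lambda>q\<in>I. r q) = (\<Pi>\<^sub>M q\<in>I. ?M q)"
      unfolding offsets_def
      by (rule distr_PiM_reindex[where f = id, simplified]) (auto simp: measure_pmf.prob_space_axioms)
    also have "\<dots> = (\<Pi>\<^sub>M q\<in>I. distr offsets (?M q) (\<lambda>r. r q))"
      unfolding offsets_def
      by (intro PiM_cong refl distr_PiM_component[symmetric]) (auto simp: measure_pmf.prob_space_axioms)
    finally show "distr offsets (\<Pi>\<^sub>M q\<in>I. ?M q) (\<lambda>r. \<lambda>q\<in>I. r q) =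
        (\<Pi>\<^sub>M q\<in>I. distr offsets (?M q) (\<lambda>r. r q))" .
  qed
  then show ?thesis by (rule indep_vars_compose2) simp
qed

lemma expectation_hit:
  assumes "q \<in> Q"
  shows "(\<integral>r. of_bool (tau r q \<in> A) \<partial>offsets) = real (card (A \<inter> {s q..<s q + l q})) / real (l q)"
proof -
  let ?M = "\<lambda>q. measure_pmf (map_pmf real (pmf_of_set {..<l q}))"
  let ?h = "\<lambda>x. of_bool (s q + nat \<lfloor>x\<rfloor> mod l q \<in> A) :: real"
  have comp: "(\<lambda>r. r q) \<in> measurable offsets (?M q)"
    unfolding offsets_def by (rule measurable_component_singleton) simp
  have ne: "{..<l q} \<noteq> {}" using pos[OF assms] by auto
  have "(\<integral>r. of_bool (tau r q \<in> A) \<partial>offsets) = (\<integral>r. ?h (r q) \<partial>offsets)"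
    by (simp add: tau_def)
  also have "\<dots> = (\<integral>x. ?h x \<partial>distr offsets (?M q) (\<lambda>r. r q))"
    by (rule integral_distr[OF comp, symmetric]) simp
  also have "distr offsets (?M q) (\<lambda>r. r q) = ?M q"
    unfolding offsets_def by (rule distr_PiM_component) (auto simp: measure_pmf.prob_space_axioms)
  also have "(\<integral>x. ?h x \<partial>?M q) = (\<integral>k. ?h (real k) \<partial>measure_pmf (pmf_of_set {..<l q}))" by simp
  also have "\<dots> = (\<Sum>k<l q. ?h (real k)) / real (l q)"
    using ne by (subst integral_pmf_of_set) auto
  also have "(\<Sum>k<l q. ?h (real k)) = (\<Sum>k<l q. of_bool (s q + k \<in> A))"
    by (intro sum.cong) auto
  also have "\<dots> = (\<Sum>n\<in>{s q..<s q + l q}. of_bool (n \<in> A))"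
    by (rule sum.reindex_bij_witness[of _ "\<lambda>n. n - s q" "\<lambda>k. s q + k"]) auto
  also have "\<dots> = real (card (A \<inter> {s q..<s q + l q}))"
    by (simp add: of_bool_def sum.inter_filter[symmetric] Int_def conj_commute)
  finally show ?thesis .
qed

lemma sum_card_slots_le:
  assumes "finite I" "I \<subseteq> Q" "finite A"
  shows "(\<Sum>q\<in>I. card (A \<inter> {s q..<s q + l q})) \<le> card A"
proof -
  have "(\<Sum>q\<in>I. card (A \<inter> {s q..<s q + l q})) = card (\<Union>q\<in>I. A \<inter> {s q..<s q + l q})"
  proof (rule card_UN_disjoint[symmetric])
    show "\<forall>q\<in>I. \<forall>q'\<in>I. q \<noteq> q' \<longrightarrow> (A \<inter> {s q..<s q + l q}) \<inter> (A \<inter> {s q'..<s q' + l q'}) = {}"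
    proof (intro ballI impI)
      fix q q' assume "q \<in> I" "q' \<in> I" "q \<noteq> q'"
      then show "(A \<inter> {s q..<s q + l q}) \<inter> (A \<inter> {s q'..<s q' + l q'}) = {}"
        using disjoint[of q q'] assms(2) by blast
    qed
  qed (use assms in auto)
  also have "\<dots> \<le> card A" by (rule card_mono) (use assms in auto)
  finally show ?thesis .
qed

text \<open>Hoeffding for the number of slots whose time lands in \<open>A\<close>. A slot in
  \<open>F\<close> adds at most 1 to the mean, any other at most \<open>\<delta>\<close> per point
  of \<open>A\<close> in it; by disjointness the mean is at most
  \<open>card F + \<delta> * i\<close>. The second \<open>\<delta> * i\<close> is the deviation, and
  \<open>card I \<le> i\<close> makes the tail bound geometric in \<open>i\<close>.\<close>

lemma explore_hits_prob:
  assumes "finite A" "card A \<le> i" "0 < i" "0 < \<delta>"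
  defines "I \<equiv> {q \<in> Q. A \<inter> {s q..<s q + l q} \<noteq> {}}"
    and "F \<equiv> {q \<in> Q. l q < nat \<lceil>1 / \<delta>\<rceil>}"
  shows "finite I"
    and "measure offsets {r. (\<Sum>q\<in>I. of_bool (tau r q \<in> A)) \<ge> real (card F) + 2 * \<delta> * real i}
      \<le> exp (- 2 * \<delta>\<^sup>2) ^ i"
proof -
  interpret prob_space offsets by (rule prob_space_offsets)
  let ?c = "\<lambda>q. card (A \<inter> {s q..<s q + l q})"
  have IQ: "I \<subseteq> Q" by (auto simp: I_def)
  have finF: "finite F" unfolding F_def by (rule long)
  have c_pos: "1 \<le> ?c q" if "q \<in> I" for q
    using that assms(1) by (simp add: I_def Suc_le_eq card_gt_0_iff)
  \<comment> \<open>Disjoint slots each containing a point of \<open>A\<close> cannot outnumber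
    \<open>A\<close>. Finite subfamilies come first, since finiteness of \<open>I\<close> is derived
    from this bound.\<close>
  have card_le: "card J \<le> i" if "finite J" "J \<subseteq> I" for J
  proof -
    have "card J = (\<Sum>q\<in>J. 1)" by simp
    also have "\<dots> \<le> (\<Sum>q\<in>J. ?c q)" by (intro sum_mono c_pos) (use that in auto)
    also have "\<dots> \<le> i"
      using sum_card_slots_le[OF that(1) _ assms(1)] that(2) IQ assms(2) by force
    finally show ?thesis .
  qed
  show fin: "finite I"
  proof (rule ccontr)
    assume "infinite I"
    then obtain J where "J \<subseteq> I" "finite J" "card J = Suc i"
      using infinite_arbitrarily_large by blast
    then show False using card_le[of J] by simp
  qed
  define Z where "Z q r = (of_bool (tau r q \<in> A) :: real)" for q r
  interpret Hoeffding_ineq offsets I Z "\<lambda>_. 0" "\<lambda>_. 1" "\<Sum>q\<in>I. expectation (Z q)"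
  proof unfold_locales
    show "indep_vars (\<lambda>_. borel) Z I"
      unfolding Z_def tau_def
      by (rule indep_component_offsets[where f = "\<lambda>q x. of_bool (s q + nat \<lfloor>x\<rfloor> mod l q \<in> A)"])
  qed (auto simp: fin Z_def)
  have EZ: "expectation (Z q) = real (?c q) / real (l q)" if "q \<in> I" for q
    unfolding Z_def using expectation_hit[of q A] that IQ by auto
  have EZ_le: "expectation (Z q) \<le> of_bool (q \<in> F) + \<delta> * real (?c q)" if q: "q \<in> I" for q
  proof (cases "q \<in> F")
    case True
    have "?c q \<le> card {s q..<s q + l q}" by (intro card_mono) auto
    then have "expectation (Z q) \<le> 1" using pos[of q] q IQ by (simp add: EZ[OF q] divide_le_eq_1 subset_iff)
    then show ?thesis using True assms(4) by (simp add: add_increasing2)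
  next
    case False
    then have "\<not> l q < nat \<lceil>1 / \<delta>\<rceil>" using q IQ unfolding F_def by blast
    then have "1 / \<delta> \<le> real (l q)"
      using real_nat_ceiling_ge[of "1 / \<delta>"] by (meson not_less of_nat_mono order_trans)
    then have "1 / real (l q) \<le> \<delta>"
      using assms(4) pos[of q] q IQ by (auto simp: field_simps)
    then have "real (?c q) * (1 / real (l q)) \<le> real (?c q) * \<delta>" by (intro mult_left_mono) auto
    then show ?thesis using False by (simp add: EZ[OF q] mult.commute)
  qed
  have "(\<Sum>q\<in>I. expectation (Z q)) \<le> (\<Sum>q\<in>I. of_bool (q \<in> F) + \<delta> * real (?c q))"
    by (intro sum_mono EZ_le)
  also have "\<dots> = real (card (I \<inter> F)) + \<delta> * real (\<Sum>q\<in>I. ?c q)"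
    using fin by (simp add: sum.distrib sum_distrib_left of_bool_def sum.inter_filter[symmetric] Int_def)
  also have "\<dots> \<le> real (card F) + \<delta> * real i"
  proof (intro add_mono mult_left_mono)
    show "real (card (I \<inter> F)) \<le> real (card F)" using finF by (simp add: card_mono)
    show "real (\<Sum>q\<in>I. ?c q) \<le> real i"
      using order_trans[OF sum_card_slots_le[OF fin IQ assms(1)] assms(2)] by (rule of_nat_mono)
  qed (use assms(4) in simp)
  finally have mu_le: "(\<Sum>q\<in>I. expectation (Z q)) \<le> real (card F) + \<delta> * real i" .
  show "prob {r. (\<Sum>q\<in>I. of_bool (tau r q \<in> A)) \<ge> real (card F) + 2 * \<delta> * real i} \<le> exp (- 2 * \<delta>\<^sup>2) ^ i"
  proof (cases "I = {}")
    case True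
    \<comment> \<open>With no relevant slot the sum is 0 and misses the positive threshold; the
      other case divides by \<open>card I\<close>.\<close>
    have "real (card F) + 2 * \<delta> * real i > 0" using assms(3,4) by (simp add: add_nonneg_pos)
    then show ?thesis using True by simp
  next
    case False
    then have I_pos: "0 < card I" using fin by auto
    have "prob {r. (\<Sum>q\<in>I. of_bool (tau r q \<in> A)) \<ge> real (card F) + 2 * \<delta> * real i}
        \<le> prob {r \<in> space offsets. (\<Sum>q\<in>I. Z q r) \<ge> (\<Sum>q\<in>I. expectation (Z q)) + \<delta> * real i}"
    proof (rule finite_measure_mono)
      show "{r \<in> space offsets. (\<Sum>q\<in>I. Z q r) \<ge> (\<Sum>q\<in>I. expectation (Z q)) + \<delta> * real i} \<in> sets offsets"
        by measurable
    qed (use mu_le in \<open>auto simp: Z_def\<close>)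
    also have "\<dots> \<le> exp (- 2 * (\<delta> * real i)\<^sup>2 / (\<Sum>q\<in>I. (1 - 0)\<^sup>2))"
      by (rule Hoeffding_ineq_ge) (use assms I_pos in auto)
    also have "\<dots> \<le> exp (real i * (- 2 * \<delta>\<^sup>2))"
    proof -
      have "real i * (2 * \<delta>\<^sup>2) * real (card I) \<le> real i * (2 * \<delta>\<^sup>2) * real i"
        using card_le[OF fin] by (intro mult_left_mono) auto
      then show ?thesis using I_pos by (simp add: field_simps power2_eq_square)
    qed
    also have "\<dots> = exp (- 2 * \<delta>\<^sup>2) ^ i" by (rule exp_of_nat_mult)
    finally show ?thesis .
  qed
qed

text \<open>For a fixed enumeration \<open>\<kappa>\<close> of the targets and fixed proposals \<open>y\<close>, the slots whose
  explore time falls on one of the first \<open>i\<close> targets are independent events, at most \<open>i\<close> slots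
  matter, and long slots make each of them unlikely.\<close>

lemma explore_hits_negligible:
  fixes y \<kappa> :: "nat \<Rightarrow> 'u"
  assumes "inj y"
  shows "AE r in offsets. (\<lambda>i. real (card (y ` {n. explore r n} \<inter> \<kappa> ` {..<i})) / real i) \<longlonglongrightarrow> 0"
proof -
  interpret prob_space offsets by (rule prob_space_offsets)
  define A where "A i = y -` (\<kappa> ` {..<i})" for i
  define I where "I i = {q \<in> Q. A i \<inter> {s q..<s q + l q} \<noteq> {}}" for i
  have finA: "finite (A i)" for i
    unfolding A_def by (rule finite_vimageI) (use assms in auto)
  have cardA: "card (A i) \<le> i" for i
  proof -
    have "card (A i) = card (y ` A i)" by (metis card_image inj_on_subset assms subset_UNIV)
    also have "\<dots> \<le> card (\<kappa> ` {..<i})" by (intro card_mono) (auto simp: A_def)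
    also have "\<dots> \<le> i" using card_image_le[of "{..<i}" \<kappa>] by simp
    finally show ?thesis .
  qed
  define F where "F \<delta> = {q \<in> Q. l q < nat \<lceil>1 / \<delta>\<rceil>}" for \<delta> :: real
  have finI: "finite (I i)" if "0 < i" for i
    using explore_hits_prob(1)[OF finA cardA that, of 1] by (simp add: I_def)
  have hits_le: "real (card (y ` {n. explore r n} \<inter> \<kappa> ` {..<i})) \<le> (\<Sum>q\<in>I i. of_bool (tau r q \<in> A i))"
    if "0 < i" for r i
  proof -
    have "y ` {n. explore r n} \<inter> \<kappa> ` {..<i} \<subseteq> (\<lambda>q. y (tau r q)) ` {q \<in> I i. tau r q \<in> A i}"
    proof
      fix x assume x: "x \<in> y ` {n. explore r n} \<inter> \<kappa> ` {..<i}"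
      then obtain q where q: "q \<in> Q" "x = y (tau r q)" by (auto simp: explore_def)
      with x have "tau r q \<in> A i" by (auto simp: A_def)
      moreover from this have "q \<in> I i" using q tau_mem[of q r] by (auto simp: I_def)
      ultimately show "x \<in> (\<lambda>q. y (tau r q)) ` {q \<in> I i. tau r q \<in> A i}" using q by blast
    qed
    then have "card (y ` {n. explore r n} \<inter> \<kappa> ` {..<i}) \<le> card {q \<in> I i. tau r q \<in> A i}"
      using finI[OF that] by (intro surj_card_le) auto
    then show ?thesis using finI[OF that] by (simp add: of_bool_def sum.inter_filter[symmetric])
  qed
  have ae: "AE r in offsets. \<forall>\<^sub>F i in sequentially.
      real (card (y ` {n. explore r n} \<inter> \<kappa> ` {..<i})) \<le> real (card (F \<delta>)) + 2 * \<delta> * real i"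
    if \<delta>: "0 < \<delta>" for \<delta>
  proof -
    define E where "E i = {r. (\<Sum>q\<in>I i. of_bool (tau r q \<in> A i)) \<ge> real (card (F \<delta>)) + 2 * \<delta> * real i}" for i
    have meas: "E i \<in> sets offsets" for i
    proof -
      have "{r \<in> space offsets. (\<Sum>q\<in>I i. of_bool (s q + nat \<lfloor>r q\<rfloor> mod l q \<in> A i)) \<ge>
          real (card (F \<delta>)) + 2 * \<delta> * real i} \<in> sets offsets"
        by measurable
      then show ?thesis by (simp add: E_def tau_def)
    qed
    have "summable (\<lambda>i. prob (E i))"
    proof (rule summable_comparison_test_ev)
      show "\<forall>\<^sub>F i in sequentially. norm (prob (E i)) \<le> exp (- 2 * \<delta>\<^sup>2) ^ i"
        using eventually_gt_at_top[of 0]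
      proof eventually_elim
        case (elim i)
        then show ?case using explore_hits_prob(2)[OF finA cardA elim \<delta>]
          by (simp add: E_def I_def F_def)
      qed
      show "summable (\<lambda>i. exp (- 2 * \<delta>\<^sup>2) ^ i)"
        by (rule summable_geometric) (use \<delta> in simp)
    qed
    then have "AE r in offsets. \<forall>\<^sub>F i in sequentially. r \<in> space offsets - E i"
      by (intro borel_cantelli_AE1 meas) (auto simp: emeasure_eq_measure)
    then show ?thesis
    proof eventually_elim
      case (elim r)
      then show ?case using eventually_gt_at_top[of 0]
      proof eventually_elim
        case (elim i)
        then show ?case using hits_le[of i r] by (simp add: E_def)
      qed
    qed
  qed
  \<comment> \<open>Restricting \<open>\<delta>\<close> to the values \<open>1 / Suc k\<close> lets
    the exceptional null sets be united.\<close>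
  have "AE r in offsets. \<forall>k. \<forall>\<^sub>F i in sequentially.
      real (card (y ` {n. explore r n} \<inter> \<kappa> ` {..<i})) \<le>
        real (card (F (1 / real (Suc k)))) + 2 * (1 / real (Suc k)) * real i"
    unfolding AE_all_countable by (intro allI ae) simp
  then show ?thesis
  proof eventually_elim
    case (elim r)
    let ?N = "\<lambda>i. real (card (y ` {n. explore r n} \<inter> \<kappa> ` {..<i}))"
    show ?case
    proof (rule tendstoI)
      fix \<epsilon> :: real assume "\<epsilon> > 0"
      \<comment> \<open>Half of \<open>\<epsilon>\<close> covers the slope \<open>2 / Suc k\<close>,
        the other half the constant count of short slots divided by \<open>i\<close>.\<close>
      then obtain k where k: "1 / real (Suc k) < \<epsilon> / 4"
        using reals_Archimedean[of "\<epsilon> / 4"] by (auto simp: inverse_eq_divide)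
      define f where "f = real (card (F (1 / real (Suc k))))"
      have "(\<lambda>i. f / real i) \<longlonglongrightarrow> 0" by (rule lim_const_over_n)
      then have "\<forall>\<^sub>F i in sequentially. f / real i < \<epsilon> / 2"
        by (rule order_tendstoD(2)) (use \<open>\<epsilon> > 0\<close> in simp)
      then show "\<forall>\<^sub>F i in sequentially. dist (?N i / real i) 0 < \<epsilon>"
        using elim[rule_format, of k] eventually_gt_at_top[of 0]
      proof eventually_elim
        case (elim i)
        have "?N i / real i \<le> (f + 2 * (1 / real (Suc k)) * real i) / real i"
          using elim by (intro divide_right_mono) (auto simp: f_def)
        also have "\<dots> = f / real i + 2 * (1 / real (Suc k))" using elim by (simp add: add_divide_distrib)
        also have "\<dots> < \<epsilon>" using elim(1) k by linarith
        finally show ?case by simp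
      qed
    qed
  qed
qed

end

section \<open>Deadlines and hallucinations\<close>

context slots
begin

text \<open>Slots are disjoint, so at most one \<open>q\<close> qualifies, and every explore time
  lies in a slot.\<close>

definition target :: "(nat \<Rightarrow> 'v) \<Rightarrow> nat \<Rightarrow> 'v" where
  "target f n = f (SOME q. q \<in> Q \<and> n \<in> {s q..<s q + l q})"

lemma target_eq:
  assumes "q \<in> Q" "n \<in> {s q..<s q + l q}"
  shows "target f n = f q"
proof -
  have "(SOME q. q \<in> Q \<and> n \<in> {s q..<s q + l q}) = q"
    by (rule some_equality) (use assms disjoint in blast)+
  then show ?thesis by (simp add: target_def)
qed

text \<open>If the target \<open>y n\<close> of a slot that ends by time \<open>d\<close> is proposed by \<open>b\<close> only after \<open>d\<close>, then it is
  still unobserved at the explore time of its slot and is output there at the latest.\<close>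

lemma deadline_met:
  fixes X :: "nat \<Rightarrow> 'u" and b
  defines "y \<equiv> outputs b X"
  assumes "generator b" "q \<in> Q" "f q = y n" "s q + l q \<le> d"
    and o'_def: "o' = outputs (\<lambda>h. run b (mix_prog u (explore r) (target f) h)) X"
  shows "y n \<in> o' ` {..<d} \<or> explore r n"
proof (cases "n < d")
  case True
  have rec: "o' n = avoid u (o' ` {..<n} \<union> X ` {..n}) (if explore r n then target f n else y n)"
    unfolding o'_def y_def by (rule outputs_mix_prog_rec)
  have "y n \<notin> X ` {..n}" using assms(2) unfolding y_def generator_def by blast
  then have "y n \<in> o' ` {..n}" if "\<not> explore r n"
    using avoid_image[of o' n u "X ` {..n}" "y n"] rec that by simp
  then show ?thesis using True by auto
next
  case False
  define k where "k = tau r q"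
  have k: "k \<in> {s q..<s q + l q}" unfolding k_def by (rule tau_mem) fact
  have "explore r k" unfolding explore_def k_def using assms(3) by blast
  moreover have "target f k = y n" using target_eq[OF assms(3) k, of f] assms(4) by simp
  ultimately have rec: "o' k = avoid u (o' ` {..<k} \<union> X ` {..k}) (y n)"
    using outputs_mix_prog_rec[of b u "explore r" "target f" X k] unfolding o'_def by simp
  have "k < d" using k assms(5) by simp
  \<comment> \<open>The black box never proposes an observed element; since
    \<open>k < d \<le> n\<close>, its late proposal shows that \<open>y n\<close> is still
    unobserved at time \<open>k\<close>.\<close>
  have "y n \<notin> X ` {..n}" using assms(2) unfolding y_def generator_def by blast
  then have "y n \<notin> X ` {..k}" using \<open>k < d\<close> False by auto
  then have "y n \<in> o' ` {..k}" using avoid_image[OF rec] by simp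
  then show ?thesis using \<open>k < d\<close> by auto
qed

lemma randomized_generator_mix_prog:
  assumes "inj u"
  shows "randomized_generator offsets (\<lambda>r h. run b (mix_prog u (explore r) w h))"
  unfolding randomized_generator_def run_mix_prog
proof (intro conjI allI ballI)
  show "prob_space offsets" by (rule prob_space_offsets)
  show "(\<lambda>r. last (mix u (explore r) w ((!) (map (\<lambda>k. b (take (Suc k) h)) [0..<length h])) ((!) h) (length h)))
      \<in> measurable offsets (count_space UNIV)" for h
    by (rule measurable_mix) (rule measurable_explore)
  show "generator (\<lambda>h. last (mix u (explore r) w ((!) (map (\<lambda>k. b (take (Suc k) h)) [0..<length h])) ((!) h) (length h)))"
    for r
    using generator_mix_prog[OF assms, of b "explore r" w] unfolding run_mix_prog .
qed

lemma hallucination_rate_le: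
  assumes "generator b" "consistent_from b K X T" "finite {q \<in> Q. s q < t}"
  shows "hallucination_rate offsets (\<lambda>r h. run b (mix_prog u (explore r) w h)) K X t
    \<le> real (T + card {q \<in> Q. s q < t}) / real t"
proof -
  interpret prob_space offsets by (rule prob_space_offsets)
  let ?o = "\<lambda>r. outputs (\<lambda>h. run b (mix_prog u (explore r) w h)) X"
  have bound: "card (?o r ` {..<t} - K) \<le> T + card {q \<in> Q. s q < t}" for r
  proof -
    have "card (?o r ` {..<t} - K) \<le> T + card {n. n < t \<and> explore r n}"
    proof (rule hallucination_count)
      show "inj (outputs b X)" by (rule generator_inj) fact
      show "?o r n = outputs b X n" if "\<not> explore r n" "outputs b X n \<notin> ?o r ` {..<n}" for n
        using that assms(1) outputs_mix_prog_rec[of b u "explore r" w X n]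
        by (auto simp: avoid_def generator_def)
      show "outputs b X n \<in> K" if "T \<le> n" for n using that assms(2) by (simp add: consistent_from_def)
    qed
    also have "\<dots> \<le> T + card {q \<in> Q. s q < t}" using card_explore_le[OF assms(3)] by simp
    finally show ?thesis .
  qed
  \<comment> \<open>The bound holds for every seed. A non-integrable function would have integral 0
    by convention, which satisfies it as well.\<close>
  show ?thesis unfolding hallucination_rate_def
  proof (cases "integrable offsets (\<lambda>r. real (card (?o r ` {..<t} - K)) / real t)")
    case True
    then show "(\<integral>r. real (card (?o r ` {..<t} - K)) / real t \<partial>offsets) \<le> real (T + card {q \<in> Q. s q < t}) / real t"
      by (rule integral_le_const) (intro AE_I2 divide_right_mono of_nat_mono bound, simp)
  next
    case False
    then have "(\<integral>r. real (card (?o r ` {..<t} - K)) / real t \<partial>offsets) = 0"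
      by (rule not_integrable_integral_eq)
    then show "(\<integral>r. real (card (?o r ` {..<t} - K)) / real t \<partial>offsets) \<le> real (T + card {q \<in> Q. s q < t}) / real t"
      by (rule order_trans[OF eq_refl]) simp
  qed
qed

end

section \<open>Assembling the generator and its guarantees\<close>

theorem theorem11:
  fixes u :: "nat \<Rightarrow> 'u" and D :: "nat \<Rightarrow> nat" and H :: "nat \<Rightarrow> real"
  assumes "bij u" and "feasible_profile D H"
  shows "\<exists>(M :: (nat \<Rightarrow> real) measure)
            (P :: (nat \<Rightarrow> 'u set) \<Rightarrow> (nat \<Rightarrow> real) \<Rightarrow> 'u list \<Rightarrow> ('u list, 'u, 'u) oracle_prog).
    \<forall>B. MVYZ_generator u B \<longrightarrow>
      (let A = with_black_box P B in
       \<forall>L. collection L \<longrightarrow>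
         randomized_generator M (A L) \<and>
         (\<forall>K\<in>range L. \<forall>X\<in>fin_cont K.
            AE r in M. liminf (\<lambda>i. ereal (mu i (outputs (A L r) X) (listing u K) D)) \<ge> 1/2) \<and>
         (\<forall>K\<in>range L. \<forall>X\<in>fin_cont K.
            \<forall>\<^sub>F t in sequentially. hallucination_rate M (A L) K X t \<le> H t) \<and>
         (\<forall>T. \<forall>\<^sub>F t in sequentially.
            (SUP K\<in>range L. SUP X\<in>{X \<in> fin_cont K. consistent_from (B L) K X T}.
               ereal (hallucination_rate M (A L) K X t)) \<le> ereal (H t)))"
proof -
  obtain Q s l and lang idx :: "nat \<Rightarrow> nat" where "slots Q s l"
    and targeted: "\<And>i. \<forall>\<^sub>F j in sequentially. \<exists>q\<in>Q. lang q = i \<and> idx q = j \<and> s q + l q \<le> D (Suc j)"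
    and budget: "\<And>T. \<forall>\<^sub>F t in sequentially. finite {q \<in> Q. s q < t} \<and>
          real (T + card {q \<in> Q. s q < t}) \<le> real t * H t"
    by (rule feasible_slots[OF assms(2)]) (rule that)
  interpret slots Q s l by fact
  \<comment> \<open>The slots depend on \<open>D\<close> and \<open>H\<close> alone; a collection
    only decides which element each slot explores. Hence \<open>offsets\<close> serves all
    collections and \<open>P\<close> never refers to the black box.\<close>
  define f where "f L q = listing u (L (lang q)) (idx q)" for L :: "nat \<Rightarrow> 'u set" and q
  define P where "P L r = mix_prog u (explore r) (target (f L))" for L r
  show ?thesis
  proof (intro exI[of _ offsets] exI[of _ P] allI impI)
    fix B assume B: "MVYZ_generator u B"
    have A_eq: "with_black_box P B L = (\<lambda>r h. run (B L) (mix_prog u (explore r) (target (f L)) h))" for L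
      by (intro ext) (simp add: with_black_box_def P_def)
    have *: "randomized_generator offsets (with_black_box P B L) \<and>
         (\<forall>K\<in>range L. \<forall>X\<in>fin_cont K.
            AE r in offsets. liminf (\<lambda>i. ereal (mu i (outputs (with_black_box P B L r) X) (listing u K) D)) \<ge> 1/2) \<and>
         (\<forall>K\<in>range L. \<forall>X\<in>fin_cont K.
            \<forall>\<^sub>F t in sequentially. hallucination_rate offsets (with_black_box P B L) K X t \<le> H t) \<and>
         (\<forall>T. \<forall>\<^sub>F t in sequentially.
            (SUP K\<in>range L. SUP X\<in>{X \<in> fin_cont K. consistent_from (B L) K X T}.
               ereal (hallucination_rate offsets (with_black_box P B L) K X t)) \<le> ereal (H t))"
      if L: "collection L" for L
    proof -
      let ?A = "with_black_box P B L"
      have gen: "generator (B L)" using B L by (simp add: MVYZ_generator_def)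
      have generator: "randomized_generator offsets ?A"
        unfolding A_eq by (rule randomized_generator_mix_prog) (use assms(1) in \<open>simp add: bij_is_inj\<close>)
      \<comment> \<open>\<open>K\<close> and \<open>X\<close> enter the threshold on
        \<open>t\<close> only through the consistency time \<open>T\<close>. The same estimate
        therefore gives the pointwise bound and, for fixed \<open>T\<close>, the bound on the
        supremum.\<close>
      have rate: "hallucination_rate offsets ?A K X t \<le> H t"
        if "finite {q \<in> Q. s q < t} \<and> real (T + card {q \<in> Q. s q < t}) \<le> real t * H t" "0 < t"
          "consistent_from (B L) K X T" for K X t T
      proof -
        have "hallucination_rate offsets ?A K X t \<le> real (T + card {q \<in> Q. s q < t}) / real t"
          unfolding A_eq by (rule hallucination_rate_le[OF gen]) (use that in auto)
        also have "\<dots> \<le> H t" using that by (simp add: divide_le_eq mult.commute)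
        finally show ?thesis .
      qed
      have pointwise: "\<forall>\<^sub>F t in sequentially. hallucination_rate offsets ?A K X t \<le> H t"
        if mem: "K \<in> range L" "X \<in> fin_cont K" for K X
      proof -
        obtain T where cons: "consistent_from (B L) K X T"
          using B[unfolded MVYZ_generator_def eventually_consistent_def, THEN conjunct2, THEN conjunct1,
              rule_format, OF L mem] by blast
        show ?thesis using budget[of T] eventually_gt_at_top[of 0]
        proof eventually_elim
          case (elim t)
          then show ?case using cons by (rule rate)
        qed
      qed
      have uniform: "\<forall>\<^sub>F t in sequentially.
          (SUP K\<in>range L. SUP X\<in>{X \<in> fin_cont K. consistent_from (B L) K X T}.
             ereal (hallucination_rate offsets ?A K X t)) \<le> ereal (H t)" for T
        using budget[of T] eventually_gt_at_top[of 0]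
      proof eventually_elim
        case (elim t)
        show ?case by (intro SUP_least) (simp add: rate[OF elim])
      qed
      have density: "AE r in offsets. liminf (\<lambda>i. ereal (mu i (outputs (?A r) X) (listing u K) D)) \<ge> 1/2"
        if "K \<in> range L" and X: "X \<in> fin_cont K" for K X
      proof -
        obtain i where K: "K = L i" using \<open>K \<in> range L\<close> by blast
        let ?\<kappa> = "listing u K" and ?y = "outputs (B L) X"
        have inj_\<kappa>: "inj ?\<kappa>"
          using inj_listing[OF assms(1)] L K by (auto simp: collection_def language_def)
        \<comment> \<open>From stage \<open>J\<close> on, language \<open>i\<close> has a slot in
          every window; the earlier indices have vanishing density.\<close>
        obtain J where J: "\<And>j. j \<ge> J \<Longrightarrow> \<exists>q\<in>Q. lang q = i \<and> idx q = j \<and> s q + l q \<le> D (Suc j)"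
          using targeted[of i] by (auto simp: eventually_sequentially)
        have "1 / 2 \<le> liminf (\<lambda>i. ereal (real (card (range ?y \<inter> ?\<kappa> ` {..<i})) / real i))"
          using B[unfolded MVYZ_generator_def, THEN conjunct2, THEN conjunct2, rule_format, OF L that] .
        then have low: "ereal (1 / 2) \<le> liminf (\<lambda>i. ereal (real (card (range ?y \<inter> ?\<kappa> ` {..<i})) / real i))"
          by (simp add: one_ereal_def)
        have "AE r in offsets. (\<lambda>i. real (card (?y ` {n. explore r n} \<inter> ?\<kappa> ` {..<i})) / real i) \<longlonglongrightarrow> 0"
          by (rule explore_hits_negligible) (rule generator_inj[OF gen])
        then show "AE r in offsets. liminf (\<lambda>i. ereal (mu i (outputs (?A r) X) ?\<kappa> D)) \<ge> 1/2"
        proof eventually_elim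
          case (elim r)
          let ?Z = "?y ` {n. explore r n}"
          have hit: "?\<kappa> j \<in> outputs (?A r) X ` {..<D (Suc j)} \<or> ?\<kappa> j \<in> ?Z"
            if "J \<le> j" "?\<kappa> j \<in> range ?y" for j
          proof -
            obtain n where n: "?\<kappa> j = ?y n" using \<open>?\<kappa> j \<in> range ?y\<close> by blast
            obtain q where q: "q \<in> Q" "lang q = i" "idx q = j" "s q + l q \<le> D (Suc j)" using J[OF \<open>J \<le> j\<close>] by blast
            have "f L q = ?y n" using q n K by (simp add: f_def)
            then have "?y n \<in> outputs (?A r) X ` {..<D (Suc j)} \<or> explore r n"
              unfolding A_eq by (rule deadline_met[OF gen q(1) _ q(4) refl])
            then show ?thesis unfolding n by blast
          qed
          have "(\<lambda>i. real J / real i + real (card (?Z \<inter> ?\<kappa> ` {..<i})) / real i) \<longlonglongrightarrow> 0 + 0"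
            by (intro tendsto_add lim_const_over_n elim)
          then have "(\<lambda>i. real (J + card (?Z \<inter> ?\<kappa> ` {..<i})) / real i) \<longlonglongrightarrow> 0"
            by (simp add: add_divide_distrib)
          then have "ereal (1 / 2) \<le> liminf (\<lambda>i. ereal (mu i (outputs (?A r) X) ?\<kappa> D))"
          proof (rule Liminf_ge_perturb[OF low])
            show "\<forall>\<^sub>F i in sequentially. real (card (range ?y \<inter> ?\<kappa> ` {..<i})) / real i -
                real (J + card (?Z \<inter> ?\<kappa> ` {..<i})) / real i \<le> mu i (outputs (?A r) X) ?\<kappa> D"
              using eventually_gt_at_top[of 0] by eventually_elim (rule mu_lower_bound[OF inj_\<kappa> _ hit])
          qed
          then show ?case by (simp add: one_ereal_def)
        qed
      qed
      show ?thesis by (intro conjI ballI allI generator density pointwise uniform)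
    qed
    show "let A = with_black_box P B in
       \<forall>L. collection L \<longrightarrow>
         randomized_generator offsets (A L) \<and>
         (\<forall>K\<in>range L. \<forall>X\<in>fin_cont K.
            AE r in offsets. liminf (\<lambda>i. ereal (mu i (outputs (A L r) X) (listing u K) D)) \<ge> 1/2) \<and>
         (\<forall>K\<in>range L. \<forall>X\<in>fin_cont K.
            \<forall>\<^sub>F t in sequentially. hallucination_rate offsets (A L) K X t \<le> H t) \<and>
         (\<forall>T. \<forall>\<^sub>F t in sequentially.
            (SUP K\<in>range L. SUP X\<in>{X \<in> fin_cont K. consistent_from (B L) K X T}.
               ereal (hallucination_rate offsets (A L) K X t)) \<le> ereal (H t))"
      unfolding Let_def by (intro allI impI *)
  qed
qed

end
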